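(* Let $r_1=\mathrm{rank}(\mathcal{M}_1)$ and define $\hat{\mathcal{M}}_1=\mathcal{M}_1\vee U_{k-r_1}$. If the objective function $f(S)$ is monotone, then the optimization problem $$\text{maximize}\ f(S)\quad\text{s.t.}\quad|S|\le k,\ (V\setminus S)\in\mathcal{M}_1^{\ast}$$ has the same solution as $$\text{maximize}\ f(S)\quad\text{s.t.}\quad S\in\hat{\mathcal{M}}_1 .$$
   Context: $V=\{1,\dots,n\}$ indexes the states of a solvable system $F\dot{\mathbf{x}}(t)=A\mathbf{x}(t)$, where $F=Q_F+T_F$, $A=Q_A+T_A$ are $n\times n$; $Q_F,Q_A$ are known fixed real matrices and $T_F,T_A$ are structure matrices whose nonzero entries are independent free real parameters. $f:2^V\to\mathbb{R}_{\ge0}$, and $k$ is the maximum number of inputs. $T_B(S)$ is the $n\times n$ diagonal matrix with a free parameter in the $i$-th diagonal entry for $i\in S$ and zeros elsewhere. $\mathcal{M}([I|Q_A|0])$ and $\mathcal{M}([I|T_A|T_B(S)])$ denote the linear matroids on the common set of $3n$ column indices (free parameters algebraically independent); $\vee$ is matroid union. $\rho_1(S)=\mathrm{rank}(\mathcal{M}([I|Q_A|0])\vee\mathcal{M}([I|T_A|T_B(S)]))-\mathrm{rank}(\mathcal{M}([I|Q_A])\vee\mathcal{M}([I|T_A]))$ is the rank function of a matroid $\mathcal{M}_1$ on $V$; $\mathcal{M}_1^{\ast}$ is its dual. $U_j$ is the uniform matroid on $V$ whose independent sets are those of size at most $j$. $X\in\mathcal{M}$ means $X$ is independent in $\mathcal{M}$.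 *)

theory Defs
  imports
    "HOL-Analysis.Analysis"
    "HOL-Computational_Algebra.Polynomial"
    "HOL-Library.Poly_Mapping"
begin

section \<open>Matroids, given by their families of independent sets\<close>

text \<open>The ground set is the whole (finite) element type.\<close>

definition matroid_rank :: "'e set set \<Rightarrow> nat" where
  "matroid_rank \<I> = Max (card ` \<I>)"

definition matroid_bases :: "'e set set \<Rightarrow> 'e set set" where
  "matroid_bases \<I> = {B \<in> \<I>. \<forall>X\<in>\<I>. B \<subseteq> X \<longrightarrow> X = B}"

text \<open>The bases of the dual are the complements of the bases.\<close>

definition matroid_dual :: "'e set set \<Rightarrow> 'e set set" where
  "matroid_dual \<I> = {X. \<exists>B\<in>matroid_bases \<I>. X \<subseteq> - B}"

definition matroid_union :: "'e set set \<Rightarrow> 'e set set \<Rightarrow> 'e set set"  (infixl "\<or>\<^sub>M" 65) where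
  "\<I> \<or>\<^sub>M \<J> = {X \<union> Y |X Y. X \<in> \<I> \<and> Y \<in> \<J>}"

text \<open>The bound is an integer, so that the difference of a number of inputs and a rank is not
  truncated: for a negative bound no set is independent, not even the empty one.\<close>

definition uniform_matroid :: "int \<Rightarrow> 'e::finite set set" where
  "uniform_matroid j = {X. int (card X) \<le> j}"

text \<open>Independence is that of the family of columns: equal columns at different indices are
  dependent.\<close>

definition linear_matroid :: "real^'c^'r \<Rightarrow> 'c set set" where
  "linear_matroid M =
     {X. inj_on (\<lambda>j. column j M) X \<and> independent ((\<lambda>j. column j M) ` X)}"

definition hcat :: "real^'c^'r \<Rightarrow> real^'d^'r \<Rightarrow> real^('c + 'd)^'r"  (infixr "\<parallel>" 60) where
  "M \<parallel> N = (\<chi> i j. case j of Inl c \<Rightarrow> M $ i $ c | Inr d \<Rightarrow> N $ i $ d)"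


section \<open>Independent free parameters\<close>

definition real_subfield :: "real set \<Rightarrow> bool" where
  "real_subfield K \<longleftrightarrow> 1 \<in> K \<and> (\<forall>x\<in>K. \<forall>y\<in>K. x - y \<in> K \<and> x * y \<in> K \<and> inverse x \<in> K)"

definition poly_eval :: "('v \<Rightarrow> real) \<Rightarrow> (('v \<Rightarrow>\<^sub>0 nat) \<Rightarrow>\<^sub>0 real) \<Rightarrow> real" where
  "poly_eval x p = (\<Sum>m\<in>Poly_Mapping.keys p. Poly_Mapping.lookup p m * (\<Prod>v\<in>Poly_Mapping.keys m. x v ^ Poly_Mapping.lookup m v))"

definition alg_independent :: "real set \<Rightarrow> ('v \<Rightarrow> real) \<Rightarrow> 'v set \<Rightarrow> bool" where
  "alg_independent K x V \<longleftrightarrow>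
     (\<forall>p. (\<forall>m\<in>Poly_Mapping.keys p. Poly_Mapping.lookup p m \<in> K \<and> Poly_Mapping.keys m \<subseteq> V) \<and> poly_eval x p = 0 \<longrightarrow> p = 0)"

text \<open>The free parameters are the nonzero entries of the structure matrices together with the
  potential diagonal entries \<open>b $ i\<close> of the input matrix. Genericity is expressed as for mixed
  matrices: the parameters are reals that are jointly algebraically independent over a subfield
  containing the entries of the fixed matrices.\<close>

fun free_param ::
  "real^'n^'n \<Rightarrow> real^'n^'n \<Rightarrow> real^'n \<Rightarrow> 'n \<times> 'n + 'n \<times> 'n + 'n \<Rightarrow> real" where
  "free_param T\<^sub>F T\<^sub>A b (Inl (i, j)) = T\<^sub>F $ i $ j"
| "free_param T\<^sub>F T\<^sub>A b (Inr (Inl (i, j))) = T\<^sub>A $ i $ j"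
| "free_param T\<^sub>F T\<^sub>A b (Inr (Inr i)) = b $ i"

definition param_positions ::
  "real^'n^'n \<Rightarrow> real^'n^'n \<Rightarrow> ('n \<times> 'n + 'n \<times> 'n + 'n) set" where
  "param_positions T\<^sub>F T\<^sub>A =
     {Inl (i, j) |i j. T\<^sub>F $ i $ j \<noteq> 0} \<union> {Inr (Inl (i, j)) |i j. T\<^sub>A $ i $ j \<noteq> 0}
     \<union> range (\<lambda>i. Inr (Inr i))"

definition structured_over ::
  "real set \<Rightarrow> real^'n^'n \<Rightarrow> real^'n^'n \<Rightarrow> real^'n^'n \<Rightarrow> real^'n^'n \<Rightarrow> real^'n \<Rightarrow> bool" where
  "structured_over K Q\<^sub>F T\<^sub>F Q\<^sub>A T\<^sub>A b \<longleftrightarrow>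
     real_subfield K \<and> (\<forall>i j. Q\<^sub>F $ i $ j \<in> K \<and> Q\<^sub>A $ i $ j \<in> K) \<and>
     alg_independent K (free_param T\<^sub>F T\<^sub>A b) (param_positions T\<^sub>F T\<^sub>A)"

text \<open>Solvability of \<open>F x' = A x\<close>: the pencil \<open>z F - A\<close> is regular, i.e. its determinant is not the
  zero polynomial in \<open>z\<close>.\<close>

definition solvable_system :: "real^'n^'n \<Rightarrow> real^'n^'n \<Rightarrow> bool" where
  "solvable_system F A \<longleftrightarrow> det (\<chi> i j. [:- (A $ i $ j), F $ i $ j:]) \<noteq> 0"


section \<open>The matroid of input sets\<close>

definition input_matrix :: "real^'n \<Rightarrow> 'n set \<Rightarrow> real^'n^'n" where
  "input_matrix b S = (\<chi> i j. if i = j \<and> i \<in> S then b $ i else 0)"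

definition rho1 :: "real^'n^'n \<Rightarrow> real^'n^'n \<Rightarrow> real^'n \<Rightarrow> 'n set \<Rightarrow> int" where
  "rho1 Q\<^sub>A T\<^sub>A b S =
     int (matroid_rank (linear_matroid (mat 1 \<parallel> Q\<^sub>A \<parallel> (0 :: real^'n^'n)) \<or>\<^sub>M
                        linear_matroid (mat 1 \<parallel> T\<^sub>A \<parallel> input_matrix b S)))
     - int (matroid_rank (linear_matroid (mat 1 \<parallel> Q\<^sub>A) \<or>\<^sub>M linear_matroid (mat 1 \<parallel> T\<^sub>A)))"

text \<open>A matroid is recovered from its rank function: the independent sets are those whose rank
  equals their cardinality.\<close>

definition matroid1 :: "real^'n^'n \<Rightarrow> real^'n^'n \<Rightarrow> real^'n \<Rightarrow> 'n set set" where
  "matroid1 Q\<^sub>A T\<^sub>A b = {S. rho1 Q\<^sub>A T\<^sub>A b S = int (card S)}"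

end

theory Submission
  imports Defs
begin

text \<open>
  A set is feasible for the first problem iff it has at most \<open>k\<close> elements and contains a basis of
  \<open>M1\<close>; it is feasible for the second iff it is the union of an independent set of \<open>M1\<close> and a set
  of at most \<open>k - r1\<close> elements. If all bases of \<open>M1\<close> have \<open>r1\<close> elements, then the first kind of
  set is also of the second kind, and every set of the second kind can be enlarged to one of the
  first kind by completing its \<open>M1\<close>-part to a basis. For monotone \<open>f\<close> this gives everything.

  What has to be shown, therefore, is that the bases of \<open>M1\<close> are equicardinal. Let \<open>N\<close> be the union
  of the linear matroids of \<open>[I | Q\<^sub>A | 0]\<close> and \<open>[I | T\<^sub>A | T\<^sub>B(V)]\<close>; it is a matroid by the matroid
  union theorem (\<open>matroid_matroid_union\<close>). Replacing \<open>T\<^sub>B(V)\<close> by \<open>T\<^sub>B(S)\<close> turns the input columns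
  outside \<open>S\<close> into loops of both matroids, which amounts to restricting \<open>N\<close> to \<open>E \<union> S\<close>, where \<open>E\<close>
  consists of the first two blocks of columns. Hence \<open>rho1 S = r\<^sub>N(E \<union> S) - r\<^sub>N(E)\<close>
  (\<open>rho1_eq_contraction_rank\<close>): \<open>M1\<close> is the contraction of \<open>N\<close> by \<open>E\<close>, and its bases are
  equicardinal by \<open>contraction_basis_card_ge\<close>.
\<close>

text \<open>Matroids on a finite element type, as nonempty families of independent sets that are closed
  under subsets and satisfy the augmentation property.\<close>

definition matroid :: "'e::finite set set \<Rightarrow> bool" where
  "matroid \<I> \<longleftrightarrow> {} \<in> \<I> \<and> (\<forall>X\<in>\<I>. \<forall>Y. Y \<subseteq> X \<longrightarrow> Y \<in> \<I>) \<and>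
     (\<forall>X\<in>\<I>. \<forall>Y\<in>\<I>. card X < card Y \<longrightarrow> (\<exists>y\<in>Y - X. insert y X \<in> \<I>))"

lemma matroid_empty: "matroid \<I> \<Longrightarrow> {} \<in> \<I>"
  by (simp add: matroid_def)

lemma matroid_subset: "matroid \<I> \<Longrightarrow> X \<in> \<I> \<Longrightarrow> Y \<subseteq> X \<Longrightarrow> Y \<in> \<I>"
  by (auto simp: matroid_def)

lemma matroid_augment:
  assumes "matroid \<I>" "X \<in> \<I>" "Y \<in> \<I>" "card X < card Y"
  obtains y where "y \<in> Y - X" "insert y X \<in> \<I>"
  using assms unfolding matroid_def by blast

lemma card_le_matroid_rank:
  fixes \<I> :: "'e::finite set set"
  shows "X \<in> \<I> \<Longrightarrow> card X \<le> matroid_rank \<I>"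
  by (simp add: matroid_rank_def)

lemma matroid_rank_witness:
  fixes \<I> :: "'e::finite set set"
  assumes "\<I> \<noteq> {}"
  obtains X where "X \<in> \<I>" "card X = matroid_rank \<I>"
proof -
  have "matroid_rank \<I> \<in> card ` \<I>"
    unfolding matroid_rank_def using assms by (intro Max_in) auto
  with that show ?thesis by auto
qed

lemma ex_matroid_basis:
  fixes \<I> :: "'e::finite set set"
  assumes "X \<in> \<I>"
  obtains B where "B \<in> matroid_bases \<I>" "X \<subseteq> B"
proof -
  obtain B where "B \<in> \<I>" "X \<subseteq> B" "\<forall>Y\<in>\<I>. B \<subseteq> Y \<longrightarrow> B = Y"
    using finite_has_maximal2[of \<I> X] assms by auto
  then have "B \<in> matroid_bases \<I>" unfolding matroid_bases_def by blast
  with \<open>X \<subseteq> B\<close> show ?thesis using that by blast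
qed

lemma matroid_union_mem: "X \<in> \<I> \<Longrightarrow> Y \<in> \<J> \<Longrightarrow> X \<union> Y \<in> \<I> \<or>\<^sub>M \<J>"
  by (auto simp: matroid_union_def)

section \<open>The matroid union theorem\<close>

lemma matroid_union_disjoint:
  assumes "matroid \<J>" "S \<in> \<I> \<or>\<^sub>M \<J>"
  obtains X Y where "X \<in> \<I>" "Y \<in> \<J>" "X \<inter> Y = {}" "S = X \<union> Y"
proof -
  obtain X Y where XY: "X \<in> \<I>" "Y \<in> \<J>" "S = X \<union> Y"
    using assms(2) by (auto simp: matroid_union_def)
  show ?thesis
    using XY that[of X "Y - X"] matroid_subset[OF assms(1), of Y "Y - X"] by blast
qed

text \<open>An augmentation step within one of the two matroids. An element that already belongs to the
  other part moves from there to this part; the two parts then overlap less with the opposite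
  parts of \<open>T\<close>.\<close>

lemma matroid_union_augment_step:
  assumes \<I>: "matroid \<I>" and \<J>: "matroid \<J>"
    and X: "X \<in> \<I>" "Y \<in> \<J>" "X \<inter> Y = {}"
    and X': "X' \<in> \<I>" "X' \<inter> Y' = {}" "card X < card X'"
  shows "(\<exists>t \<in> X' - (X \<union> Y). insert t (X \<union> Y) \<in> \<I> \<or>\<^sub>M \<J>) \<or>
    (\<exists>U\<in>\<I>. \<exists>W\<in>\<J>. U \<inter> W = {} \<and> U \<union> W = X \<union> Y \<and>
       card (U \<inter> Y') + card (W \<inter> X') < card (X \<inter> Y') + card (Y \<inter> X'))"
proof -
  obtain t where t: "t \<in> X' - X" "insert t X \<in> \<I>"
    using matroid_augment[OF \<I> X(1) X'(1,3)] .
  show ?thesis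
  proof (cases "t \<in> Y")
    case True
    have "insert t X \<inter> Y' = X \<inter> Y'" using t X' by auto
    moreover have "card ((Y - {t}) \<inter> X') < card (Y \<inter> X')"
      using True t by (intro psubset_card_mono) auto
    moreover have "Y - {t} \<in> \<J>" using matroid_subset[OF \<J> X(2)] by blast
    moreover have "insert t X \<inter> (Y - {t}) = {}" "insert t X \<union> (Y - {t}) = X \<union> Y"
      using X(3) True by auto
    ultimately show ?thesis
      using t(2) by (intro disjI2 bexI[of _ "insert t X"] bexI[of _ "Y - {t}"]) auto
  next
    case False
    then show ?thesis
      using t matroid_union_mem[OF t(2) X(2)] by (intro disjI1 bexI[of _ t]) auto
  qed
qed

lemma matroid_union_commute: "\<I> \<or>\<^sub>M \<J> = \<J> \<or>\<^sub>M \<I>"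
  by (auto simp: matroid_union_def Un_commute)

text \<open>For the augmentation property, write \<open>S\<close> and \<open>T\<close> as disjoint unions of an \<open>\<I>\<close>-part and a
  \<open>\<J>\<close>-part. If \<open>S\<close> is smaller than \<open>T\<close>, then one of its parts is smaller than the corresponding part
  of \<open>T\<close> and can be augmented from it. The overlap of the parts of \<open>S\<close> with the opposite parts of
  \<open>T\<close> is the measure that lets the exchange steps terminate.\<close>

theorem matroid_matroid_union:
  assumes \<I>: "matroid \<I>" and \<J>: "matroid \<J>"
  shows "matroid (\<I> \<or>\<^sub>M \<J>)"
proof -
  have aug: "\<exists>t\<in>(X' \<union> Y') - (X \<union> Y). insert t (X \<union> Y) \<in> \<I> \<or>\<^sub>M \<J>"
    if "X \<in> \<I>" "Y \<in> \<J>" "X \<inter> Y = {}" "X' \<in> \<I>" "Y' \<in> \<J>" "X' \<inter> Y' = {}"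
      "card (X \<union> Y) < card (X' \<union> Y')"
    for X Y X' Y'
    using that
  proof (induction "card (X \<inter> Y') + card (Y \<inter> X')" arbitrary: X Y rule: less_induct)
    case less
    have IH: ?case
      if "U \<in> \<I>" "W \<in> \<J>" "U \<inter> W = {}" "U \<union> W = X \<union> Y"
        "card (U \<inter> Y') + card (W \<inter> X') < card (X \<inter> Y') + card (Y \<inter> X')" for U W
      using less.hyps[of U W] that less.prems by simp
    have "card X + card Y < card X' + card Y'"
      using less.prems by (simp add: card_Un_disjoint)
    then consider "card X < card X'" | "card Y < card Y'" by linarith
    then show ?case
    proof cases
      case 1
      from matroid_union_augment_step[OF \<I> \<J> less.prems(1-4,6) 1] IH show ?thesis by blast
    next
      case 2
      have "Y \<inter> X = {}" "Y' \<inter> X' = {}" using less.prems by auto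
      from matroid_union_augment_step[OF \<J> \<I> less.prems(2,1) this(1) less.prems(5) this(2) 2]
      consider t where "t \<in> Y' - (Y \<union> X)" "insert t (Y \<union> X) \<in> \<J> \<or>\<^sub>M \<I>"
        | U W where "U \<in> \<J>" "W \<in> \<I>" "U \<inter> W = {}" "U \<union> W = Y \<union> X"
          "card (U \<inter> X') + card (W \<inter> Y') < card (Y \<inter> X') + card (X \<inter> Y')"
        by blast
      then show ?thesis
      proof cases
        case 1
        then show ?thesis by (auto simp: matroid_union_commute[of \<J>] Un_commute)
      next
        case 2
        then show ?thesis by (intro IH[of W U]) auto
      qed
    qed
  qed
  show ?thesis
    unfolding matroid_def
  proof (intro conjI ballI allI impI)
    show "{} \<in> \<I> \<or>\<^sub>M \<J>"
      using matroid_union_mem[OF matroid_empty[OF \<I>] matroid_empty[OF \<J>]] by simp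
  next
    fix S T assume "S \<in> \<I> \<or>\<^sub>M \<J>" "T \<subseteq> S"
    then obtain X Y where XY: "X \<in> \<I>" "Y \<in> \<J>" "T = (X \<inter> T) \<union> (Y \<inter> T)"
      by (auto simp: matroid_union_def)
    have "X \<inter> T \<in> \<I>" "Y \<inter> T \<in> \<J>"
      using matroid_subset[OF \<I> XY(1)] matroid_subset[OF \<J> XY(2)] by auto
    then show "T \<in> \<I> \<or>\<^sub>M \<J>" using matroid_union_mem XY(3) by metis
  next
    fix S T assume S: "S \<in> \<I> \<or>\<^sub>M \<J>" and T: "T \<in> \<I> \<or>\<^sub>M \<J>" and card: "card S < card T"
    show "\<exists>t\<in>T - S. insert t S \<in> \<I> \<or>\<^sub>M \<J>"
      using matroid_union_disjoint[OF \<J> S] matroid_union_disjoint[OF \<J> T] aug card by metis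
  qed
qed

section \<open>Bases of contractions\<close>

text \<open>If \<open>S\<close> is independent in the contraction of \<open>N\<close> by \<open>E\<close>, then a maximum independent subset of
  \<open>E \<union> S\<close> consists of \<open>S\<close> and a basis of \<open>E\<close>. The map \<open>h\<close> embeds the ground set of the contraction
  into that of \<open>N\<close>.\<close>

lemma contraction_independent_split:
  fixes N :: "'e::finite set set" and E :: "'e set" and h :: "'a::finite \<Rightarrow> 'e"
  assumes N: "matroid N" and h: "inj h"
    and S: "matroid_rank {X \<in> N. X \<subseteq> E \<union> h ` S} = matroid_rank {X \<in> N. X \<subseteq> E} + card S"
  obtains J where "J \<subseteq> E" "J \<union> h ` S \<in> N" "card J = matroid_rank {X \<in> N. X \<subseteq> E}"
    "card (J \<union> h ` S) = card J + card S"
proof -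
  let ?r = "matroid_rank {X \<in> N. X \<subseteq> E}"
  have "{X \<in> N. X \<subseteq> E \<union> h ` S} \<noteq> {}" using matroid_empty[OF N] by blast
  then obtain J where J: "J \<in> N" "J \<subseteq> E \<union> h ` S" "card J = ?r + card S"
    using matroid_rank_witness S by (metis (mono_tags, lifting) mem_Collect_eq)
  have hS: "card (h ` S) = card S" using h by (meson card_image inj_on_subset subset_UNIV)
  have "J \<inter> E \<in> N" using matroid_subset[OF N J(1)] by blast
  then have le: "card (J \<inter> E) \<le> ?r" by (intro card_le_matroid_rank) auto
  have "card J = card (J \<inter> E) + card (J - E)"
    using card_Un_disjoint[of "J \<inter> E" "J - E"] by (simp add: Un_Diff_Int Int_Diff_disjoint Int_Diff_Un)
  moreover have sub: "J - E \<subseteq> h ` S" using J by auto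
  then have "card (J - E) \<le> card S" using card_mono[of "h ` S"] hS by auto
  ultimately have eq: "card (J \<inter> E) = ?r" "card (J - E) = card S" using le J(3) by auto
  then have "J - E = h ` S" using sub hS by (intro card_subset_eq) auto
  then have "J \<inter> E \<union> h ` S = J" by auto
  then show ?thesis using that[of "J \<inter> E"] J eq by simp
qed

lemma contraction_basis_card_ge:
  fixes N :: "'e::finite set set" and E :: "'e set" and h :: "'a::finite \<Rightarrow> 'e"
  assumes N: "matroid N" and h: "inj h"
  defines "M \<equiv> {S. matroid_rank {X \<in> N. X \<subseteq> E \<union> h ` S} =
                   matroid_rank {X \<in> N. X \<subseteq> E} + card S}"
  assumes B: "B \<in> matroid_bases M" and S: "S \<in> M"
  shows "card S \<le> card B"
proof (rule ccontr)
  assume less: "\<not> card S \<le> card B"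
  let ?r = "matroid_rank {X \<in> N. X \<subseteq> E}"
  have BM: "B \<in> M" using B by (simp add: matroid_bases_def)
  obtain J where J: "J \<subseteq> E" "J \<union> h ` B \<in> N" "card J = ?r" "card (J \<union> h ` B) = card J + card B"
    using contraction_independent_split[OF N h] BM unfolding M_def by blast
  obtain L where L: "L \<subseteq> E" "L \<union> h ` S \<in> N" "card L = ?r" "card (L \<union> h ` S) = card L + card S"
    using contraction_independent_split[OF N h] S unfolding M_def by blast
  obtain t where t: "t \<in> (L \<union> h ` S) - (J \<union> h ` B)" "insert t (J \<union> h ` B) \<in> N"
    using matroid_augment[OF N J(2) L(2)] less J L by auto
  \<comment> \<open>\<open>t\<close> is not in \<open>E\<close>, where \<open>J\<close> is already maximum.\<close>
  have "t \<notin> E"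
  proof
    assume "t \<in> E"
    then have "insert t J \<subseteq> E" using J by auto
    moreover have "insert t J \<in> N" using matroid_subset[OF N t(2)] by blast
    ultimately have "card (insert t J) \<le> ?r" by (intro card_le_matroid_rank) auto
    then show False using t J by auto
  qed
  then obtain s where s: "t = h s" "s \<notin> B" using t L by auto
  let ?Z = "{X \<in> N. X \<subseteq> E \<union> h ` insert s B}"
  have "?Z \<noteq> {}" using matroid_empty[OF N] by blast
  then obtain X where X: "X \<in> N" "X \<subseteq> E \<union> h ` insert s B" "card X = matroid_rank ?Z"
    using matroid_rank_witness by (metis (mono_tags, lifting) mem_Collect_eq)
  have "X \<inter> E \<in> N" using matroid_subset[OF N X(1)] by blast
  then have "card (X \<inter> E) \<le> ?r" by (intro card_le_matroid_rank) auto
  moreover have "card (X - E) \<le> card (insert s B)"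
  proof -
    have "card (X - E) \<le> card (h ` insert s B)" using X by (intro card_mono) auto
    also have "\<dots> \<le> card (insert s B)" by (rule card_image_le) simp
    finally show ?thesis .
  qed
  moreover have "card X \<le> card (X \<inter> E) + card (X - E)"
    using card_Un_le[of "X \<inter> E" "X - E"] by (simp add: Int_Diff_Un)
  ultimately have upper: "matroid_rank ?Z \<le> ?r + card (insert s B)" using X by auto
  have "insert t (J \<union> h ` B) \<in> ?Z" using t s J by auto
  then have "card (insert t (J \<union> h ` B)) \<le> matroid_rank ?Z" by (rule card_le_matroid_rank)
  moreover have "card (insert t (J \<union> h ` B)) = ?r + card (insert s B)"
    using t s J by simp
  ultimately have "insert s B \<in> M" unfolding M_def using upper by simp
  then show False using B s unfolding matroid_bases_def by blast
qed

section \<open>Linear matroids\<close>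

lemma column_hcat:
  "column (Inl i) (M \<parallel> N) = column i M" "column (Inr j) (M \<parallel> N) = column j N"
  by (simp_all add: column_def hcat_def)

lemma linear_matroid_column_nonzero:
  assumes "X \<in> linear_matroid M" "j \<in> X"
  shows "column j M \<noteq> 0"
proof
  assume "column j M = 0"
  with assms(2) have "0 \<in> (\<lambda>j. column j M) ` X" by (metis imageI)
  then have "dependent ((\<lambda>j. column j M) ` X)" by (rule dependent_zero)
  with assms(1) show False by (simp add: linear_matroid_def)
qed

lemma linear_matroid_cong:
  assumes "\<And>j. j \<in> X \<Longrightarrow> column j M = column j M'"
  shows "X \<in> linear_matroid M \<longleftrightarrow> X \<in> linear_matroid M'"
proof -
  have "inj_on (\<lambda>j. column j M) X \<longleftrightarrow> inj_on (\<lambda>j. column j M') X"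
    using assms by (rule inj_on_cong)
  moreover have "(\<lambda>j. column j M) ` X = (\<lambda>j. column j M') ` X"
    using assms by (rule image_cong[OF refl])
  ultimately show ?thesis by (simp add: linear_matroid_def)
qed

lemma linear_matroid_image:
  assumes g: "inj g" and col: "\<And>j. column (g j) M' = column j M"
  shows "g ` X \<in> linear_matroid M' \<longleftrightarrow> X \<in> linear_matroid M"
proof -
  have "inj_on (\<lambda>j. column j M') (g ` X) \<longleftrightarrow> inj_on (\<lambda>j. column j M) X"
    using comp_inj_on_iff[OF inj_on_subset[OF g subset_UNIV], of "\<lambda>j. column j M'" X]
    by (simp add: o_def col)
  then show ?thesis by (simp add: linear_matroid_def image_image col)
qed

lemma matroid_linear_matroid:
  fixes M :: "real^'c::finite^'r::finite"
  shows "matroid (linear_matroid M)"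
  unfolding matroid_def
proof (intro conjI ballI allI impI)
  show "{} \<in> linear_matroid M" by (simp add: linear_matroid_def independent_empty)
next
  fix X Y assume "X \<in> linear_matroid M" "Y \<subseteq> X"
  then show "Y \<in> linear_matroid M"
    using independent_mono[OF _ image_mono] inj_on_subset
    unfolding linear_matroid_def mem_Collect_eq by metis
next
  fix X Y assume X: "X \<in> linear_matroid M" and Y: "Y \<in> linear_matroid M"
    and card: "card X < card Y"
  let ?c = "\<lambda>j. column j M"
  have "\<not> ?c ` Y \<subseteq> span (?c ` X)"
  proof
    assume "?c ` Y \<subseteq> span (?c ` X)"
    then have "card (?c ` Y) \<le> card (?c ` X)"
      using Y independent_span_bound[of "?c ` X" "?c ` Y"] by (auto simp: linear_matroid_def)
    then show False using X Y card by (simp add: linear_matroid_def card_image)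
  qed
  then obtain y where y: "y \<in> Y" "?c y \<notin> span (?c ` X)" by auto
  have notin: "?c y \<notin> ?c ` X" using y(2) by (rule contrapos_nn) (rule span_base)
  then have "y \<notin> X" by auto
  moreover have "insert y X \<in> linear_matroid M"
    using X y(2) notin \<open>y \<notin> X\<close> by (simp add: linear_matroid_def independent_insert)
  ultimately show "\<exists>y\<in>Y - X. insert y X \<in> linear_matroid M" using y(1) by blast
qed

section \<open>The matroid of input sets as a contraction\<close>

lemma column_input_matrix:
  "column j (input_matrix b S) = (if j \<in> S then column j (input_matrix b UNIV) else 0)"
  by (auto simp: column_def input_matrix_def vec_eq_iff)

text \<open>The embedding of the first two blocks of columns.\<close>

definition state_col :: "'a + 'b \<Rightarrow> 'a + 'b + 'c" where
  "state_col = case_sum Inl (Inr \<circ> Inl)"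

text \<open>The embedding of the third block of columns.\<close>

definition input_col :: "'c \<Rightarrow> 'a + 'b + 'c" where
  "input_col = Inr \<circ> Inr"

lemma inj_state_col: "inj state_col"
  by (auto simp: inj_def state_col_def split: sum.splits)

lemma inj_input_col: "inj input_col"
  by (auto simp: inj_def input_col_def)

lemma column_hcat3:
  "column (state_col j) (M \<parallel> N \<parallel> P) = column j (M \<parallel> N)"
  "column (input_col i) (M \<parallel> N \<parallel> P) = column i P"
  by (cases j) (simp_all add: state_col_def input_col_def column_hcat)

lemma state_or_input_col:
  obtains j where "x = state_col j" | i where "x = input_col i"
proof (cases x)
  case (Inl a)
  then show ?thesis using that(1)[of "Inl a"] by (simp add: state_col_def)
next
  case (Inr y)
  then show ?thesis
    using that(1)[of "Inr (projl y)"] that(2)[of "projr y"]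
    by (cases y) (simp_all add: state_col_def input_col_def)
qed

lemma zero_column: "column j 0 = 0"
  by (simp add: column_def vec_eq_iff)

lemma linear_matroid_zero_block:
  assumes "X \<in> linear_matroid (M \<parallel> N \<parallel> 0)"
  shows "X \<subseteq> range state_col"
proof
  fix x assume "x \<in> X"
  with assms have "column x (M \<parallel> N \<parallel> 0) \<noteq> 0" by (rule linear_matroid_column_nonzero)
  then show "x \<in> range state_col"
    by (cases x rule: state_or_input_col) (auto simp: column_hcat3 zero_column)
qed

lemma linear_matroid_input_matrix:
  "X \<in> linear_matroid (M \<parallel> N \<parallel> input_matrix b S) \<longleftrightarrow>
   X \<in> linear_matroid (M \<parallel> N \<parallel> input_matrix b UNIV) \<and> X \<subseteq> range state_col \<union> input_col ` S"
proof -
  have sub: "X \<subseteq> range state_col \<union> input_col ` S"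
    if X: "X \<in> linear_matroid (M \<parallel> N \<parallel> input_matrix b S)"
  proof
    fix x assume "x \<in> X"
    with X have "column x (M \<parallel> N \<parallel> input_matrix b S) \<noteq> 0" by (rule linear_matroid_column_nonzero)
    then show "x \<in> range state_col \<union> input_col ` S"
      by (cases x rule: state_or_input_col)
        (auto simp: column_hcat3 column_input_matrix[of _ b S] split: if_splits)
  qed
  have "X \<in> linear_matroid (M \<parallel> N \<parallel> input_matrix b S) \<longleftrightarrow>
        X \<in> linear_matroid (M \<parallel> N \<parallel> input_matrix b UNIV)"
    if "X \<subseteq> range state_col \<union> input_col ` S"
    using that
    by (intro linear_matroid_cong) (auto simp: column_hcat3 column_input_matrix[of _ b S])
  with sub show ?thesis by blast
qed

text \<open>Both matroids of the union have the input columns outside \<open>S\<close> as loops.\<close>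

lemma union_input_restrict:
  "linear_matroid (M \<parallel> N \<parallel> 0) \<or>\<^sub>M linear_matroid (M' \<parallel> N' \<parallel> input_matrix b S) =
   {X \<in> linear_matroid (M \<parallel> N \<parallel> 0) \<or>\<^sub>M linear_matroid (M' \<parallel> N' \<parallel> input_matrix b UNIV).
      X \<subseteq> range state_col \<union> input_col ` S}" (is "?L = ?R")
proof -
  let ?Q = "linear_matroid (M \<parallel> N \<parallel> 0)" and ?E = "range state_col \<union> input_col ` S"
  let ?T = "\<lambda>S. linear_matroid (M' \<parallel> N' \<parallel> input_matrix b S)"
  have T: "?T S = {Y \<in> ?T UNIV. Y \<subseteq> ?E}"
    by (intro set_eqI) (simp only: mem_Collect_eq linear_matroid_input_matrix[of _ M' N' b S])
  have Q: "X \<subseteq> ?E" if "X \<in> ?Q" for X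
    using linear_matroid_zero_block[OF that] by (rule le_supI1)
  show ?thesis
  proof (rule set_eqI)
    fix Z
    have "X \<union> Y \<subseteq> ?E \<longleftrightarrow> Y \<subseteq> ?E" if "X \<in> ?Q" for X Y
      using Q[OF that] by (simp only: Un_subset_iff simp_thms)
    then show "Z \<in> ?L \<longleftrightarrow> Z \<in> ?R"
      unfolding T matroid_union_def mem_Collect_eq by metis
  qed
qed

lemma union_state_restrict:
  "(`) state_col ` (linear_matroid (M \<parallel> N) \<or>\<^sub>M linear_matroid (M' \<parallel> N')) =
   {X \<in> linear_matroid (M \<parallel> N \<parallel> P) \<or>\<^sub>M linear_matroid (M' \<parallel> N' \<parallel> P'). X \<subseteq> range state_col}"
  (is "?L = ?R")
proof
  have iff: "state_col ` X \<in> linear_matroid (M \<parallel> N \<parallel> P) \<longleftrightarrow> X \<in> linear_matroid (M \<parallel> N)"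
    for M :: "real^'a^'r" and N :: "real^'b^'r" and P :: "real^'c^'r" and X
    by (rule linear_matroid_image[OF inj_state_col column_hcat3(1)])
  show "?L \<subseteq> ?R"
  proof
    fix Z assume "Z \<in> ?L"
    then obtain U W where UW: "U \<in> linear_matroid (M \<parallel> N)" "W \<in> linear_matroid (M' \<parallel> N')"
      "Z = state_col ` U \<union> state_col ` W"
      unfolding matroid_union_def by (blast intro: image_Un)
    have "Z \<in> linear_matroid (M \<parallel> N \<parallel> P) \<or>\<^sub>M linear_matroid (M' \<parallel> N' \<parallel> P')"
      unfolding UW(3) using UW(1,2) by (intro matroid_union_mem) (simp_all only: iff)
    then show "Z \<in> ?R" using UW(3) by blast
  qed
  show "?R \<subseteq> ?L"
  proof
    fix Z assume "Z \<in> ?R"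
    then obtain X Y where XY: "X \<in> linear_matroid (M \<parallel> N \<parallel> P)"
      "Y \<in> linear_matroid (M' \<parallel> N' \<parallel> P')" "Z = X \<union> Y" "X \<subseteq> range state_col" "Y \<subseteq> range state_col"
      unfolding matroid_union_def by blast
    obtain U W where UW: "X = state_col ` U" "Y = state_col ` W"
      using XY(4,5) by (metis subset_image_iff)
    have "U \<union> W \<in> linear_matroid (M \<parallel> N) \<or>\<^sub>M linear_matroid (M' \<parallel> N')"
      using XY(1,2) unfolding UW iff by (rule matroid_union_mem)
    moreover have "Z = state_col ` (U \<union> W)" using XY UW by (simp add: image_Un)
    ultimately show "Z \<in> ?L" by blast
  qed
qed

lemma matroid_rank_image:
  assumes "inj g"
  shows "matroid_rank ((`) g ` \<I>) = matroid_rank \<I>"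
proof -
  have "card (g ` X) = card X" for X
    using assms by (meson card_image inj_on_subset subset_UNIV)
  then show ?thesis by (simp add: matroid_rank_def image_image)
qed

lemma rho1_eq_contraction_rank:
  fixes Q\<^sub>A T\<^sub>A :: "real^'n^'n" and b :: "real^'n"
  defines "N \<equiv> linear_matroid (mat 1 \<parallel> Q\<^sub>A \<parallel> (0 :: real^'n^'n)) \<or>\<^sub>M
               linear_matroid (mat 1 \<parallel> T\<^sub>A \<parallel> input_matrix b UNIV)"
  shows "rho1 Q\<^sub>A T\<^sub>A b S = int (matroid_rank {X \<in> N. X \<subseteq> range state_col \<union> input_col ` S})
           - int (matroid_rank {X \<in> N. X \<subseteq> range state_col})"
  unfolding rho1_def N_def union_input_restrict[of _ _ _ _ b S] union_state_restrict[symmetric]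
  by (simp add: matroid_rank_image inj_state_col)

lemma matroid1_basis_card:
  assumes "B \<in> matroid_bases (matroid1 Q\<^sub>A T\<^sub>A b)"
  shows "card B = matroid_rank (matroid1 Q\<^sub>A T\<^sub>A b)"
proof (rule antisym)
  let ?M = "matroid1 Q\<^sub>A T\<^sub>A b"
  let ?N = "linear_matroid (mat 1 \<parallel> Q\<^sub>A \<parallel> (0 :: real^'a^'a)) \<or>\<^sub>M
            linear_matroid (mat 1 \<parallel> T\<^sub>A \<parallel> input_matrix b UNIV)"
  have M: "?M = {S. matroid_rank {X \<in> ?N. X \<subseteq> range state_col \<union> input_col ` S} =
                    matroid_rank {X \<in> ?N. X \<subseteq> range state_col} + card S}"
    unfolding matroid1_def rho1_eq_contraction_rank by auto
  have N: "matroid ?N" by (intro matroid_matroid_union matroid_linear_matroid)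
  have B: "B \<in> ?M" using assms by (simp add: matroid_bases_def)
  then show "card B \<le> matroid_rank ?M" by (rule card_le_matroid_rank)
  from B have "?M \<noteq> {}" by (metis empty_iff)
  then obtain S where S: "S \<in> ?M" "card S = matroid_rank ?M"
    by (rule matroid_rank_witness)
  show "matroid_rank ?M \<le> card B"
    using contraction_basis_card_ge[OF N inj_input_col assms[unfolded M] S(1)[unfolded M]] S(2)
    by simp
qed

section \<open>Equivalence of the two optimization problems\<close>

theorem lemma4p3:
  fixes Q\<^sub>F T\<^sub>F Q\<^sub>A T\<^sub>A F A :: "real^'n^'n" and b :: "real^'n"
    and K :: "real set" and f :: "'n set \<Rightarrow> real" and k :: nat
  assumes "structured_over K Q\<^sub>F T\<^sub>F Q\<^sub>A T\<^sub>A b"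
    and "F = Q\<^sub>F + T\<^sub>F" and "A = Q\<^sub>A + T\<^sub>A" and "solvable_system F A"
    and "\<And>S. 0 \<le> f S" and "mono f"
  defines "M1 \<equiv> matroid1 Q\<^sub>A T\<^sub>A b"
  defines "r1 \<equiv> matroid_rank M1"
  defines "M1hat \<equiv> M1 \<or>\<^sub>M uniform_matroid (int k - int r1)"
  defines "feas \<equiv> (\<lambda>S. card S \<le> k \<and> UNIV - S \<in> matroid_dual M1)"
  defines "feas_hat \<equiv> (\<lambda>S. S \<in> M1hat)"
  shows "Max (f ` {S. feas S}) = Max (f ` {S. feas_hat S})
    \<and> (\<forall>S. is_arg_max f feas S \<longleftrightarrow> feas S \<and> is_arg_max f feas_hat S)
    \<and> (\<forall>S. is_arg_max f feas_hat S \<longrightarrow> (\<exists>S'. S \<subseteq> S' \<and> is_arg_max f feas S'))"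
proof -
  have basis_card: "card B = r1" if "B \<in> matroid_bases M1" for B
    using matroid1_basis_card that unfolding r1_def M1_def by blast
  have feas: "feas S \<longleftrightarrow> card S \<le> k \<and> (\<exists>B\<in>matroid_bases M1. B \<subseteq> S)" for S
    by (auto simp: feas_def matroid_dual_def)
  have to_hat: "feas_hat S" if S: "feas S" for S
  proof -
    obtain B where B: "B \<in> matroid_bases M1" "B \<subseteq> S" "card S \<le> k" using S feas by blast
    have "int (card (S - B)) = int (card S) - int r1"
      using B(2) basis_card[OF B(1)] card_mono[OF _ B(2)]
      by (simp add: card_Diff_subset of_nat_diff)
    then have "S - B \<in> uniform_matroid (int k - int r1)"
      using B by (simp add: uniform_matroid_def)
    moreover have "B \<in> M1" using B by (simp add: matroid_bases_def)
    ultimately have "B \<union> (S - B) \<in> M1hat" unfolding M1hat_def by (intro matroid_union_mem)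
    then show ?thesis using B by (simp add: feas_hat_def Un_absorb1)
  qed
  have enlarge: "\<exists>S'. S \<subseteq> S' \<and> feas S'" if S: "feas_hat S" for S
  proof -
    obtain X Y where XY: "S = X \<union> Y" "X \<in> M1" "int (card Y) \<le> int k - int r1"
      using S by (auto simp: feas_hat_def M1hat_def matroid_union_def uniform_matroid_def)
    obtain B where B: "B \<in> matroid_bases M1" "X \<subseteq> B" using ex_matroid_basis XY(2) .
    have "card (B \<union> Y) \<le> k" using card_Un_le[of B Y] basis_card[OF B(1)] XY(3) by linarith
    then have "feas (B \<union> Y)" using B by (auto simp: feas)
    then show ?thesis using XY B by blast
  qed
  have f_le: "S \<subseteq> S' \<Longrightarrow> f S \<le> f S'" for S S' using \<open>mono f\<close> by (rule monoD)
  have dominated: "\<exists>S'. feas S' \<and> f S \<le> f S'" if "feas_hat S" for S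
    using enlarge[OF that] f_le by blast
  have Max: "Max (f ` {S. feas S}) = Max (f ` {S. feas_hat S})"
  proof (cases "{S. feas S} = {}")
    case True
    then have "{S. feas_hat S} = {}" using enlarge by auto
    with True show ?thesis by simp
  next
    case False
    with to_hat have ne: "{S. feas_hat S} \<noteq> {}" by blast
    show ?thesis
    proof (rule antisym)
      show "Max (f ` {S. feas S}) \<le> Max (f ` {S. feas_hat S})"
        using False to_hat by (intro Max_mono) auto
      show "Max (f ` {S. feas_hat S}) \<le> Max (f ` {S. feas S})"
      proof (rule Max.boundedI)
        fix y assume "y \<in> f ` {S. feas_hat S}"
        then obtain S where "feas_hat S" "y = f S" by blast
        then obtain S' where S': "feas S'" "y \<le> f S'" using dominated by blast
        have "f S' \<le> Max (f ` {S. feas S})" using S'(1) by (intro Max_ge) auto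
        with S'(2) show "y \<le> Max (f ` {S. feas S})" by (rule order_trans)
      qed (use ne in auto)
    qed
  qed
  have argmax: "is_arg_max f feas S \<longleftrightarrow> feas S \<and> is_arg_max f feas_hat S" for S
    using to_hat dominated unfolding is_arg_max_def by (meson not_less order_trans)
  have "\<exists>S'. S \<subseteq> S' \<and> is_arg_max f feas S'" if S: "is_arg_max f feas_hat S" for S
  proof -
    obtain S' where S': "S \<subseteq> S'" "feas S'" using S enlarge unfolding is_arg_max_def by blast
    have "is_arg_max f feas S'"
      using S S'(2) to_hat f_le[OF S'(1)] unfolding is_arg_max_def
      by (meson less_le_trans le_less_trans)
    then show ?thesis using S'(1) by blast
  qed
  with Max argmax show ?thesis by blast
qed

end
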